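(* Let $q\ge1$ and let $(G_n)_{n\ge1}$ be finite connected vertex-transitive $(q+1)$-regular graphs with $|V(G_n)|\to\infty$. Suppose the empirical spectral measures $\mu_n=\frac{1}{|V(G_n)|}\sum_{\lambda\in\mathrm{Spec}(\mathbf P(G_n))}\delta_\lambda$ (eigenvalues with multiplicity) converge weakly to a probability measure $\mu_P$ on $[-1,1]$. Then for every real $t$ with $|t|<1/(q+1)$, \[ \lim_{n\to\infty}\zeta_a(G_n,t)^{-1}=(1-t^2)^{q-1}\exp\Big[\int\log\big\{(1+qt^2)^2-(q+1)^2t^2\lambda^2\big\}\,d\mu_P(\lambda)\Big]. \]
   Context: $\mathbf P(G)$ is the transition matrix of simple random walk on $G$ ($P_{uv}=1/\deg u$ if $uv\in E(G)$, else $0$). $\zeta_a(G,t)=\exp\big(\sum_{k\ge1}\frac{N^{0,a}_k}{k}t^k\big)$ is the generalized alternating zeta function, where $N^{0,a}_k$ is the number of reduced $x_0$-alternating cycles of length $k$ in the symmetric digraph $D_G$ of $G$ for a fixed vertex $x_0$. Here $D_G$ has arcs $(u,v),(v,u)$ for each edge $uv$; an alternating walk of length $r$ is an arc sequence $[e_1,\dots,e_r]$ with vertices $v_0,\dots,v_r$ such that either $e_i=(v_{i-1},v_i)$ for odd $i$ and $e_i=(v_i,v_{i-1})$ for even $i$, or $e_i=(v_i,v_{i-1})$ for odd $i$ and $e_i=(v_{i-1},v_i)$ for even $i$; an $x_0$-alternating cycle is one of even length with $v_0=v_r=x_0$; it is reduced if $e_{i+1}\ne e_i$ for all $i\le r-1$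 and $e_r\ne e_1$. *)

theory Defs
  imports "HOL-Probability.Probability" "Jordan_Normal_Form.Char_Poly"
begin

definition simple_graph :: "nat \<Rightarrow> (nat \<Rightarrow> nat \<Rightarrow> bool) \<Rightarrow> bool" where
  "simple_graph N E \<longleftrightarrow> (\<forall>u v. E u v \<longrightarrow> u < N \<and> v < N \<and> u \<noteq> v \<and> E v u)"

definition connected_graph :: "nat \<Rightarrow> (nat \<Rightarrow> nat \<Rightarrow> bool) \<Rightarrow> bool" where
  "connected_graph N E \<longleftrightarrow> (\<forall>u<N. \<forall>v<N. E\<^sup>*\<^sup>* u v)"

definition regular_graph :: "nat \<Rightarrow> (nat \<Rightarrow> nat \<Rightarrow> bool) \<Rightarrow> nat \<Rightarrow> bool" where
  "regular_graph N E d \<longleftrightarrow> (\<forall>u<N. card {v. v < N \<and> E u v} = d)"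

definition vertex_transitive :: "nat \<Rightarrow> (nat \<Rightarrow> nat \<Rightarrow> bool) \<Rightarrow> bool" where
  "vertex_transitive N E \<longleftrightarrow>
     (\<forall>u<N. \<forall>v<N. \<exists>f. bij_betw f {..<N} {..<N} \<and>
        (\<forall>a<N. \<forall>b<N. E a b \<longleftrightarrow> E (f a) (f b)) \<and> f u = v)"

definition degree :: "nat \<Rightarrow> (nat \<Rightarrow> nat \<Rightarrow> bool) \<Rightarrow> nat \<Rightarrow> nat" where
  "degree N E u = card {v. v < N \<and> E u v}"

definition trans_matrix :: "nat \<Rightarrow> (nat \<Rightarrow> nat \<Rightarrow> bool) \<Rightarrow> real mat" where
  "trans_matrix N E = mat N N (\<lambda>(u, v). if E u v then 1 / real (degree N E u) else 0)"

text \<open>Integral of f against the empirical spectral measure of a square matrix A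
  (eigenvalues with algebraic multiplicity = roots of the characteristic polynomial),
  normalised by the dimension.\<close>
definition spectral_integral :: "real mat \<Rightarrow> (real \<Rightarrow> real) \<Rightarrow> real" where
  "spectral_integral A f =
     (\<Sum>x\<in>{y. poly (char_poly A) y = 0}. real (order x (char_poly A)) * f x) / real (dim_row A)"

text \<open>Arc lists of reduced x0-alternating cycles of length r in the symmetric digraph D_G
  (lists are 0-indexed: es!j is the paper's e_(j+1), vs!j is v_j).\<close>
definition alt_walk :: "(nat \<Rightarrow> nat \<Rightarrow> bool) \<Rightarrow> nat \<Rightarrow> (nat \<times> nat) list \<Rightarrow> nat list \<Rightarrow> bool" where
  "alt_walk E r es vs \<longleftrightarrow> length es = r \<and> length vs = r + 1 \<and>
     (\<forall>i<r. E (vs!i) (vs!(i+1))) \<and>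
     ((\<forall>i<r. es!i = (if even i then (vs!i, vs!(i+1)) else (vs!(i+1), vs!i))) \<or>
      (\<forall>i<r. es!i = (if even i then (vs!(i+1), vs!i) else (vs!i, vs!(i+1)))))"

definition reduced_alt_cycles :: "(nat \<Rightarrow> nat \<Rightarrow> bool) \<Rightarrow> nat \<Rightarrow> nat \<Rightarrow> (nat \<times> nat) list set" where
  "reduced_alt_cycles E x0 r = {es. even r \<and>
     (\<exists>vs. alt_walk E r es vs \<and> vs!0 = x0 \<and> vs!r = x0) \<and>
     (\<forall>i. i + 1 < r \<longrightarrow> es!(i+1) \<noteq> es!i) \<and> es!(r-1) \<noteq> es!0}"

definition N_alt :: "(nat \<Rightarrow> nat \<Rightarrow> bool) \<Rightarrow> nat \<Rightarrow> nat \<Rightarrow> nat" where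
  "N_alt E x0 k = card (reduced_alt_cycles E x0 k)"

definition alt_zeta :: "(nat \<Rightarrow> nat \<Rightarrow> bool) \<Rightarrow> nat \<Rightarrow> real \<Rightarrow> real" where
  "alt_zeta E x0 t = exp (\<Sum>k. real (N_alt E x0 (Suc k)) / real (Suc k) * t ^ Suc k)"

end

theory Submission
  imports Defs "Jordan_Normal_Form.Schur_Decomposition"
begin

text \<open>
  The limit formula already holds exactly for every finite graph. Reversing every other arc turns a
  reduced alternating cycle into a closed tailless non-backtracking walk, and each such walk of even
  length arises twice, so by vertex-transitivity the number of reduced alternating cycles
  of even length \<open>k\<close> at a vertex is \<open>2 tr B\<^sup>k / |V|\<close>, where \<open>B\<close> is the non-backtracking
  matrix. A recursion for \<open>tr B\<^sup>k\<close> expresses it by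
  \<open>\<Sum> (\<alpha>\<^sup>k + \<beta>\<^sup>k)\<close> over the adjacency eigenvalues \<open>x = \<alpha> + \<beta>\<close> with \<open>\<alpha>\<beta> = q\<close>, up to \<open>(q - 1)|V|\<close> for
  even \<open>k\<close> (Ihara-Bass for regular graphs). Since \<open>|\<alpha>|, |\<beta>| \<le> q\<close>, the series sums to
  \<open>- ln (1 - x t + q t\<^sup>2)\<close>, and keeping even \<open>k\<close> adds the values at \<open>t\<close> and \<open>-t\<close>. The result is an
  integral of a bounded continuous function against the empirical spectral measure.
\<close>

subsection \<open>Non-backtracking walks on a regular graph\<close>

locale regular_simple_graph =
  fixes N :: nat and E :: "nat \<Rightarrow> nat \<Rightarrow> bool" and q :: nat
  assumes simple: "simple_graph N E" and regular: "regular_graph N E (q + 1)"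
begin

definition nbrs :: "nat \<Rightarrow> nat set" where "nbrs u = {v. E u v}"

lemma E_sym: "E u v \<longleftrightarrow> E v u"
  and E_less: "E u v \<Longrightarrow> u < N \<and> v < N"
  and E_irrefl: "\<not> E u u"
  using simple by (auto simp: simple_graph_def)

lemma mem_nbrs [simp]: "v \<in> nbrs u \<longleftrightarrow> E u v"
  by (simp add: nbrs_def)

lemma finite_nbrs [simp]: "finite (nbrs u)"
  by (rule finite_subset[of _ "{..<N}"]) (auto dest: E_less)

lemma card_nbrs: "u < N \<Longrightarrow> card (nbrs u) = q + 1"
proof -
  assume "u < N"
  moreover have "nbrs u = {v. v < N \<and> E u v}" by (auto dest: E_less)
  ultimately show ?thesis using regular by (simp add: regular_graph_def)
qed

text \<open>Both sides run over all arcs; reversing every arc exchanges them.\<close>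

lemma sum_nbrs_swap: "(\<Sum>x<N. \<Sum>z\<in>nbrs x. f x z) = (\<Sum>x<N. \<Sum>z\<in>nbrs x. f z x)"
  for f :: "nat \<Rightarrow> nat \<Rightarrow> real"
proof -
  have *: "(\<Sum>x<N. \<Sum>z\<in>nbrs x. g x z) = (\<Sum>x<N. \<Sum>z<N. if E x z then g x z else 0)"
    for g :: "nat \<Rightarrow> nat \<Rightarrow> real"
    by (intro sum.cong refl sum.mono_neutral_cong_left) (auto dest: E_less)
  show ?thesis
    unfolding * by (subst sum.swap) (simp add: E_sym cong: if_cong)
qed

text \<open>\<open>nb k\<close> is the \<open>k\<close>-th power of the non-backtracking (Hashimoto) matrix indexed by arcs.\<close>

primrec nb :: "nat \<Rightarrow> nat \<times> nat \<Rightarrow> nat \<times> nat \<Rightarrow> real" where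
  "nb 0 e f = of_bool (e = f)"
| "nb (Suc k) e f = (\<Sum>g\<in>nbrs (fst f) - {snd f}. nb k e (g, fst f))"

text \<open>Grouping walks by the head or tail of their last arc turns the recursion over arcs into
  one over vertices, on which the adjacency matrix acts.\<close>

definition nb_into :: "nat \<Rightarrow> nat \<times> nat \<Rightarrow> nat \<Rightarrow> real" where
  "nb_into k e y = (\<Sum>z\<in>nbrs y. nb k e (z, y))"

definition nb_outof :: "nat \<Rightarrow> nat \<times> nat \<Rightarrow> nat \<Rightarrow> real" where
  "nb_outof k e y = (\<Sum>z\<in>nbrs y. nb k e (y, z))"

text \<open>The arcs that may precede \<open>(w, z)\<close> are those into \<open>w\<close> other
  than the reversal \<open>(z, w)\<close>.\<close>

lemma nb_Suc: "E w z \<Longrightarrow> nb (Suc k) e (w, z) = nb_into k e w - nb k e (z, w)"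
  by (simp add: nb_into_def sum_diff1)

lemma nb_into_Suc: "nb_into (Suc k) e y = (\<Sum>z\<in>nbrs y. nb_into k e z) - nb_outof k e y"
  unfolding nb_into_def[of "Suc k"] nb_outof_def sum_subtractf[symmetric]
  by (intro sum.cong refl nb_Suc) (simp add: E_sym)

text \<open>Every arc into \<open>y\<close> has exactly \<open>q\<close> admissible continuations.
  Together with \<open>nb_into_Suc\<close> this eliminates \<open>nb_outof\<close> and leaves a
  two-step recursion for \<open>nb_into\<close> alone.\<close>

lemma nb_outof_Suc: "y < N \<Longrightarrow> nb_outof (Suc k) e y = real q * nb_into k e y"
proof -
  assume y: "y < N"
  have "nb_outof (Suc k) e y = (\<Sum>z\<in>nbrs y. nb_into k e y - nb k e (z, y))"
    unfolding nb_outof_def by (intro sum.cong refl nb_Suc) simp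
  also have "\<dots> = real (q + 1) * nb_into k e y - nb_into k e y"
    by (simp add: sum_subtractf card_nbrs[OF y] nb_into_def[symmetric])
  finally show ?thesis by (simp add: algebra_simps)
qed

lemma nb_into_0: "E u v \<Longrightarrow> nb_into 0 (u, v) y = of_bool (v = y)"
  using E_sym[of u v]
  by (auto simp: nb_into_def of_bool_def if_distrib sum.delta' cong: if_cong)

lemma nb_outof_0: "E u v \<Longrightarrow> nb_outof 0 (u, v) y = of_bool (u = y)"
  by (auto simp: nb_outof_def of_bool_def if_distrib sum.delta' cong: if_cong)

section \<open>Walk counts summed over starting arcs, and the trace recursion\<close>

definition nb_from_to :: "nat \<Rightarrow> nat \<Rightarrow> nat \<Rightarrow> real" where
  "nb_from_to k x y = (\<Sum>z\<in>nbrs x. nb_into k (x, z) y)"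

definition nb_via_to :: "nat \<Rightarrow> nat \<Rightarrow> nat \<Rightarrow> real" where
  "nb_via_to k x y = (\<Sum>z\<in>nbrs x. nb_into k (z, x) y)"

definition nb_trace :: "nat \<Rightarrow> real" where
  "nb_trace k = (\<Sum>x<N. \<Sum>z\<in>nbrs x. nb k (x, z) (x, z))"

text \<open>Unfold the last step twice by \<open>nb_Suc\<close>: the second correction term ends in
  the starting arc again and so returns the trace two steps earlier.\<close>

lemma nb_trace_Suc_Suc:
  "nb_trace (k + 2) = (\<Sum>x<N. nb_from_to (Suc k) x x) - (\<Sum>x<N. nb_via_to k x x) + nb_trace k"
proof -
  have "nb (k + 2) (x, z) (x, z) = nb_into (Suc k) (x, z) x - nb_into k (x, z) z + nb k (x, z) (x, z)"
    if "z \<in> nbrs x" for x z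
  proof -
    from that have "E x z" "E z x" by (auto simp: E_sym)
    then show ?thesis
      using nb_Suc[of x z "Suc k" "(x, z)"] nb_Suc[of z x k "(x, z)"]
      by (simp del: nb.simps add: numeral_2_eq_2)
  qed
  then have "nb_trace (k + 2) =
      (\<Sum>x<N. \<Sum>z\<in>nbrs x. nb_into (Suc k) (x, z) x - nb_into k (x, z) z + nb k (x, z) (x, z))"
    unfolding nb_trace_def by (intro sum.cong refl) blast
  also have "\<dots> = (\<Sum>x<N. nb_from_to (Suc k) x x) - (\<Sum>x<N. \<Sum>z\<in>nbrs x. nb_into k (x, z) z) + nb_trace k"
    by (simp add: sum.distrib sum_subtractf nb_from_to_def nb_trace_def)
  also have "(\<Sum>x<N. \<Sum>z\<in>nbrs x. nb_into k (x, z) z) = (\<Sum>x<N. nb_via_to k x x)"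
    unfolding nb_via_to_def by (rule sum_nbrs_swap)
  finally show ?thesis .
qed

text \<open>\<open>cheb k\<close> is the matrix \<open>\<alpha>\<^sup>k + \<beta>\<^sup>k\<close>, where \<open>\<alpha> + \<beta>\<close> is the adjacency matrix and \<open>\<alpha>\<beta> = q\<close>.\<close>

fun cheb :: "nat \<Rightarrow> nat \<Rightarrow> nat \<Rightarrow> real" where
  "cheb 0 x y = 2 * of_bool (x = y)"
| "cheb (Suc 0) x y = of_bool (E x y)"
| "cheb (Suc (Suc k)) x y = (\<Sum>z\<in>nbrs y. cheb (Suc k) x z) - real q * cheb k x y"

lemma nb_from_to_Suc_Suc:
  "y < N \<Longrightarrow> nb_from_to (Suc (Suc k)) x y
     = (\<Sum>z\<in>nbrs y. nb_from_to (Suc k) x z) - real q * nb_from_to k x y"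
  unfolding nb_from_to_def
  by (subst sum.swap)
    (simp add: nb_into_Suc[of "Suc k"] nb_outof_Suc sum_subtractf sum_distrib_left)

lemma nb_via_to_Suc_Suc:
  "y < N \<Longrightarrow> nb_via_to (Suc (Suc k)) x y
     = (\<Sum>z\<in>nbrs y. nb_via_to (Suc k) x z) - real q * nb_via_to k x y"
  unfolding nb_via_to_def
  by (subst sum.swap)
    (simp add: nb_into_Suc[of "Suc k"] nb_outof_Suc sum_subtractf sum_distrib_left)

lemma nb_from_to_0: "nb_from_to 0 x y = of_bool (E x y)"
proof -
  have "nb_from_to 0 x y = (\<Sum>z\<in>nbrs x. of_bool (z = y))"
    unfolding nb_from_to_def by (intro sum.cong refl nb_into_0) simp
  also have "\<dots> = of_bool (E x y)"
    by (auto simp: of_bool_def sum.delta cong: if_cong)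
  finally show ?thesis .
qed

lemma nb_via_to_0: "x < N \<Longrightarrow> nb_via_to 0 x y = real (q + 1) * of_bool (x = y)"
proof -
  assume x: "x < N"
  have "nb_via_to 0 x y = (\<Sum>z\<in>nbrs x. of_bool (x = y))"
    unfolding nb_via_to_def by (intro sum.cong refl nb_into_0) (simp add: E_sym)
  then show ?thesis by (simp add: card_nbrs[OF x])
qed

lemma nb_from_to_1:
  "x < N \<Longrightarrow> nb_from_to (Suc 0) x y
     = (\<Sum>z\<in>nbrs y. of_bool (E x z)) - real (q + 1) * of_bool (x = y)"
proof -
  assume x: "x < N"
  have "nb_from_to (Suc 0) x y
      = (\<Sum>z\<in>nbrs y. nb_from_to 0 x z) - (\<Sum>w\<in>nbrs x. nb_outof 0 (x, w) y)"
    unfolding nb_from_to_def by (subst sum.swap) (simp add: nb_into_Suc sum_subtractf)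
  also have "(\<Sum>w\<in>nbrs x. nb_outof 0 (x, w) y) = (\<Sum>w\<in>nbrs x. of_bool (x = y))"
    by (intro sum.cong refl nb_outof_0) simp
  finally show ?thesis by (simp add: nb_from_to_0 card_nbrs[OF x])
qed

lemma nb_via_to_1: "x < N \<Longrightarrow> nb_via_to (Suc 0) x y = real q * of_bool (E x y)"
proof -
  assume x: "x < N"
  have "nb_via_to (Suc 0) x y
      = (\<Sum>z\<in>nbrs y. nb_via_to 0 x z) - (\<Sum>w\<in>nbrs x. nb_outof 0 (w, x) y)"
    unfolding nb_via_to_def by (subst sum.swap) (simp add: nb_into_Suc sum_subtractf)
  also have "(\<Sum>w\<in>nbrs x. nb_outof 0 (w, x) y) = (\<Sum>w\<in>nbrs x. of_bool (w = y))"
    by (intro sum.cong refl nb_outof_0) (simp add: E_sym)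
  also have "\<dots> = of_bool (E x y)"
    by (auto simp: of_bool_def sum.delta cong: if_cong)
  also have "(\<Sum>z\<in>nbrs y. nb_via_to 0 x z) = real (q + 1) * (\<Sum>z\<in>nbrs y. of_bool (x = z))"
    by (simp add: nb_via_to_0[OF x] sum_distrib_left)
  also have "(\<Sum>z\<in>nbrs y. of_bool (x = z)) = (of_bool (E x y) :: real)"
    by (auto simp: of_bool_def sum.delta' E_sym[of y x] cong: if_cong)
  finally show ?thesis by (simp add: algebra_simps)
qed

text \<open>Both sides obey the same recursion in \<open>k\<close> (apply the adjacency matrix,
  subtract \<open>q\<close> times the term before), so agreement at \<open>k = 0\<close> and
  \<open>k = 1\<close> suffices.\<close>

lemma nb_from_to_diff_nb_via_to:
  assumes "x < N" "y < N"
  shows "nb_from_to (Suc k) x y - nb_via_to k x y = cheb (Suc (Suc k)) x y - cheb k x y"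
  using assms(2)
proof (induction k arbitrary: y rule: induct_nat_012)
  case 0
  then show ?case
    by (simp add: nb_from_to_1 nb_via_to_0 assms algebra_simps)
next
  case 1
  have "(\<Sum>z\<in>nbrs y. of_bool (x = z)) = (of_bool (E x y) :: real)"
    by (auto simp: of_bool_def sum.delta' E_sym[of y x] cong: if_cong)
  then have *: "(\<Sum>z\<in>nbrs y. c * of_bool (x = z)) = c * (of_bool (E x y) :: real)" for c
    by (simp add: sum_distrib_left[symmetric])
  show ?case
    using 1 *[of 2] *[of "real q"] *[of "real (q + 1)"] *[of "real q * 2"]
    by (simp add: nb_from_to_Suc_Suc nb_from_to_1 nb_from_to_0 nb_via_to_1 assms
        sum_subtractf algebra_simps sum.distrib)
next
  case (ge2 k)
  have "(\<Sum>z\<in>nbrs y. nb_from_to (Suc (Suc k)) x z - nb_via_to (Suc k) x z)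
      = (\<Sum>z\<in>nbrs y. cheb (Suc (Suc (Suc k))) x z - cheb (Suc k) x z)"
    by (intro sum.cong refl ge2.IH(2)) (auto dest: E_less)
  moreover have "real q * nb_from_to (Suc k) x y - real q * nb_via_to k x y
      = real q * cheb (Suc (Suc k)) x y - real q * cheb k x y"
    using ge2.IH(1)[OF ge2.prems] by (simp add: right_diff_distrib[symmetric] del: cheb.simps)
  ultimately show ?case
    using nb_from_to_Suc_Suc[OF ge2.prems, of "Suc k" x] nb_via_to_Suc_Suc[OF ge2.prems, of k x]
      cheb.simps(3)[of "Suc (Suc k)" x y] cheb.simps(3)[of k x y]
    by (simp add: sum_subtractf del: cheb.simps)
qed

text \<open>The traces of \<open>nb\<close> and \<open>cheb\<close> have equal increments from
  \<open>k\<close> to \<open>k + 2\<close>, so their difference depends only on the parity of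
  \<open>k\<close>. It is \<open>(q + 1) N - 2 N\<close> at 0, and 0 at 1 because there are no
  loops.\<close>

lemma nb_trace_eq:
  "nb_trace k = (\<Sum>x<N. cheb k x x) + of_bool (even k) * (real q - 1) * real N"
proof (induction k rule: induct_nat_012)
  case 0
  have "nb_trace 0 = (\<Sum>x<N. real (q + 1))"
    unfolding nb_trace_def by (intro sum.cong refl) (simp add: card_nbrs)
  then show ?case by (simp add: algebra_simps)
next
  case 1
  have "nb_trace (Suc 0) = (\<Sum>x<N. \<Sum>z\<in>nbrs x. 0)"
    unfolding nb_trace_def
    by (intro sum.cong refl) (auto simp: E_irrefl intro!: sum.neutral)
  then show ?case by (simp add: E_irrefl)
next
  case (ge2 k)
  have "(\<Sum>x<N. nb_from_to (Suc k) x x) - (\<Sum>x<N. nb_via_to k x x)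
      = (\<Sum>x<N. cheb (Suc (Suc k)) x x - cheb k x x)"
    unfolding sum_subtractf[symmetric]
    by (intro sum.cong refl nb_from_to_diff_nb_via_to) auto
  then show ?case
    using nb_trace_Suc_Suc[of k] ge2.IH(1) by (simp add: sum_subtractf del: cheb.simps)
qed

end

subsection \<open>Reduced alternating cycles\<close>

lemma swap_eq_iff: "prod.swap a = b \<longleftrightarrow> a = prod.swap b"
  by (metis swap_swap)

context regular_simple_graph
begin

section \<open>Non-backtracking walks as explicit lists of arcs\<close>

definition arcs :: "(nat \<times> nat) set" where "arcs = {(u, v). E u v}"

lemma mem_arcs [simp]: "(u, v) \<in> arcs \<longleftrightarrow> E u v"
  by (simp add: arcs_def)

lemma finite_arcs [simp]: "finite arcs"
  by (rule finite_subset[of _ "{..<N} \<times> {..<N}"]) (auto dest: E_less)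

definition nb_step :: "nat \<times> nat \<Rightarrow> nat \<times> nat \<Rightarrow> bool" where
  "nb_step e f \<longleftrightarrow> snd e = fst f \<and> f \<noteq> prod.swap e"

definition nb_paths :: "nat \<Rightarrow> nat \<times> nat \<Rightarrow> nat \<times> nat \<Rightarrow> (nat \<times> nat) list set" where
  "nb_paths k e f = {fs. length fs = Suc k \<and> fs ! 0 = e \<and> fs ! k = f \<and> set fs \<subseteq> arcs \<and>
     (\<forall>i<k. nb_step (fs ! i) (fs ! Suc i))}"

lemma finite_nb_paths [simp]: "finite (nb_paths k e f)"
  by (rule finite_subset[OF _ finite_lists_length_eq[OF finite_arcs, of "Suc k"]])
    (auto simp: nb_paths_def)

lemma nb_paths_Suc:
  assumes "E w z"
  shows "nb_paths (Suc k) e (w, z) = (\<Union>g\<in>nbrs w - {z}. (\<lambda>fs. fs @ [(w, z)]) ` nb_paths k e (g, w))"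
    (is "?L = ?R")
proof (intro equalityI subsetI)
  fix fs assume fs: "fs \<in> ?L"
  then have len: "length fs = Suc (Suc k)" by (simp add: nb_paths_def)
  then obtain gs f where gs: "fs = gs @ [f]" "length gs = Suc k"
    by (metis length_Suc_conv_rev)
  obtain g w' where gw: "gs ! k = (g, w')" by fastforce
  from fs gs have f: "f = (w, z)" by (auto simp: nb_paths_def nth_append)
  from fs have "nb_step (fs ! k) (fs ! Suc k)" unfolding nb_paths_def by blast
  with gs gw f have step: "w' = w" "g \<noteq> z" by (auto simp: nb_step_def nth_append)
  have "(g, w') \<in> set gs" using gs gw by (metis lessI nth_mem)
  with fs gs have "(g, w') \<in> arcs" by (auto simp: nb_paths_def)
  with step have "g \<in> nbrs w - {z}" by (simp add: E_sym)
  moreover have "nb_step (gs ! i) (gs ! Suc i)" if "i < k" for i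
  proof -
    from fs that have "nb_step (fs ! i) (fs ! Suc i)" by (auto simp: nb_paths_def)
    with that gs show ?thesis by (simp add: nth_append)
  qed
  then have "gs \<in> nb_paths k e (g, w)"
    using fs gs gw step by (auto simp: nb_paths_def nth_append)
  ultimately show "fs \<in> ?R" using gs f by blast
next
  fix fs assume "fs \<in> ?R"
  then obtain g gs where "g \<in> nbrs w - {z}" "fs = gs @ [(w, z)]" "gs \<in> nb_paths k e (g, w)"
    by blast
  then have *: "E w g" "g \<noteq> z" "fs = gs @ [(w, z)]" "gs \<in> nb_paths k e (g, w)"
    by auto
  then have "nb_step (fs ! i) (fs ! Suc i)" if "i < Suc k" for i
    using that by (auto simp: nb_paths_def nb_step_def nth_append less_Suc_eq)
  then show "fs \<in> ?L"
    using * assms by (auto simp: nb_paths_def nth_append)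
qed

text \<open>Splitting by the arc before the last one mirrors the recursion of \<open>nb\<close>; the
  pieces are disjoint because that arc can be read off the list.\<close>

lemma card_nb_paths:
  assumes "E a b" "E u v"
  shows "real (card (nb_paths k (a, b) (u, v))) = nb k (a, b) (u, v)"
  using assms(2)
proof (induction k arbitrary: u v)
  case 0
  have "nb_paths 0 (a, b) (u, v) = (if (a, b) = (u, v) then {[(a, b)]} else {})"
    using 0 by (auto simp: nb_paths_def length_Suc_conv)
  then show ?case by simp
next
  case (Suc k)
  have "card (nb_paths (Suc k) (a, b) (u, v))
      = (\<Sum>g\<in>nbrs u - {v}. card ((\<lambda>fs. fs @ [(u, v)]) ` nb_paths k (a, b) (g, u)))"
    unfolding nb_paths_Suc[OF Suc.prems]
    by (rule card_UN_disjoint) (simp_all, auto simp: nb_paths_def)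
  also have "\<dots> = (\<Sum>g\<in>nbrs u - {v}. card (nb_paths k (a, b) (g, u)))"
    by (intro sum.cong refl card_image) (auto simp: inj_on_def)
  finally have "real (card (nb_paths (Suc k) (a, b) (u, v)))
      = (\<Sum>g\<in>nbrs u - {v}. real (card (nb_paths k (a, b) (g, u))))"
    by simp
  also have "\<dots> = (\<Sum>g\<in>nbrs u - {v}. nb k (a, b) (g, u))"
    by (intro sum.cong refl Suc.IH) (auto simp: E_sym)
  finally show ?case by simp
qed

text \<open>Returning to the first arc, not merely to the first vertex, encodes that the closed walk
  has no tail.\<close>

definition nb_cycles :: "nat \<Rightarrow> nat \<Rightarrow> (nat \<times> nat) list set" where
  "nb_cycles r x = (\<Union>z\<in>nbrs x. nb_paths r (x, z) (x, z))"

lemma card_nb_cycles: "real (card (nb_cycles r x)) = (\<Sum>z\<in>nbrs x. nb r (x, z) (x, z))"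
proof -
  have "card (nb_cycles r x) = (\<Sum>z\<in>nbrs x. card (nb_paths r (x, z) (x, z)))"
    unfolding nb_cycles_def
    by (rule card_UN_disjoint) (simp_all, auto simp: nb_paths_def)
  then show ?thesis
    by (simp add: card_nb_paths)
qed

lemma finite_nb_cycles [simp]: "finite (nb_cycles r x)"
  by (simp add: nb_cycles_def)

text \<open>The last entry of a member of \<^term>\<open>nb_cycles r x\<close> repeats the first arc, so it is dropped.
  Reversing every other arc turns the no-backtracking condition into \<open>e\<^sub>i\<^sub>+\<^sub>1 \<noteq> e\<^sub>i\<close>.\<close>

definition alternate :: "nat \<Rightarrow> bool \<Rightarrow> (nat \<times> nat) list \<Rightarrow> (nat \<times> nat) list" where
  "alternate r b fs = map (\<lambda>i. if even i = b then fs ! i else prod.swap (fs ! i)) [0..<r]"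

text \<open>Of two consecutive arcs exactly one gets reversed, so equal neighbouring entries would
  mean a backtracking step. As \<open>r\<close> is even, the last and the first position also differ
  in parity, which gives the cyclic condition.\<close>

lemma alternate_mem:
  assumes r: "even r" "0 < r" and fs: "fs \<in> nb_cycles r x"
  shows "alternate r b fs \<in> reduced_alt_cycles E x r"
proof -
  from fs obtain z where z: "E x z" "length fs = Suc r" "fs ! 0 = (x, z)" "fs ! r = (x, z)"
      "set fs \<subseteq> arcs" and step: "\<And>i. i < r \<Longrightarrow> nb_step (fs ! i) (fs ! Suc i)"
    by (auto simp: nb_cycles_def nb_paths_def)
  define vs where "vs = map fst fs"
  have fs_nth: "fs ! i = (vs ! i, vs ! Suc i)" if "i < r" for i
    using step[OF that] that z by (simp add: vs_def nb_step_def prod_eq_iff)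
  have E: "E (vs ! i) (vs ! Suc i)" if "i < r" for i
  proof -
    have "fs ! i \<in> arcs" using z that by (metis less_SucI nth_mem subsetD)
    with fs_nth[OF that] show ?thesis by simp
  qed
  have nth: "alternate r b fs ! i = (if even i = b then fs ! i else prod.swap (fs ! i))"
    if "i < r" for i using that by (simp add: alternate_def)
  have walk: "alt_walk E r (alternate r b fs) vs"
    unfolding alt_walk_def
    using z E by (cases b) (auto simp: vs_def[symmetric] nth fs_nth alternate_def, auto simp: vs_def)
  have ends: "vs ! 0 = x" "vs ! r = x" using z r by (auto simp: vs_def)
  have 1: "alternate r b fs ! (i + 1) \<noteq> alternate r b fs ! i" if "i + 1 < r" for i
    using step[of i] that by (auto simp: nth nb_step_def swap_eq_iff)
  \<comment> \<open>The closing entry \<open>fs ! r\<close> equals \<open>fs ! 0\<close>, so step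
    \<open>r - 1\<close> wraps around.\<close>
  have "nb_step (fs ! (r - 1)) (fs ! 0)"
    using step[of "r - 1"] r z by simp
  moreover have "odd (r - 1)" using r by simp
  ultimately have "alternate r b fs ! (r - 1) \<noteq> alternate r b fs ! 0"
    using r by (auto simp: nth nb_step_def swap_eq_iff)
  with walk ends 1 r show ?thesis
    unfolding reduced_alt_cycles_def by auto
qed

text \<open>The vertex sequence of the cycle, read with all arcs pointing forward, is the required
  walk; \<open>b\<close> records which of the two alternation patterns was used.\<close>

lemma alternate_surj:
  assumes r: "even r" "0 < r" and es: "es \<in> reduced_alt_cycles E x r"
  shows "\<exists>b. es \<in> alternate r b ` nb_cycles r x"
proof -
  from es obtain vs where vs: "alt_walk E r es vs" "vs ! 0 = x" "vs ! r = x"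
    and red: "\<And>i. i + 1 < r \<Longrightarrow> es ! (i + 1) \<noteq> es ! i" and tail: "es ! (r - 1) \<noteq> es ! 0"
    by (auto simp: reduced_alt_cycles_def)
  then obtain b where b: "\<And>i. i < r \<Longrightarrow>
      es ! i = (if even i = b then (vs ! i, vs ! (i + 1)) else (vs ! (i + 1), vs ! i))"
    unfolding alt_walk_def by (smt (verit, ccfv_SIG))
  have len: "length es = r" and E: "\<And>i. i < r \<Longrightarrow> E (vs ! i) (vs ! Suc i)"
    using vs by (auto simp: alt_walk_def)
  \<comment> \<open>The appended copy of the first arc closes the walk. Since
    \<open>vs ! r = vs ! 0\<close>, the step into it is governed by \<open>tail\<close>, all other
    steps by \<open>red\<close>.\<close>
  define fs where "fs = map (\<lambda>i. (vs ! i, vs ! Suc i)) [0..<r] @ [(vs ! 0, vs ! 1)]"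
  have nth: "fs ! i = (vs ! i, vs ! Suc i)" if "i < r" for i
    using that by (simp add: fs_def nth_append)
  have nth_r: "fs ! r = (vs ! 0, vs ! 1)" by (simp add: fs_def nth_append)
  have es_alt: "es = alternate r b fs"
    by (rule nth_equalityI) (auto simp: len alternate_def b nth)
  have step: "nb_step (fs ! i) (fs ! Suc i)" if i: "i < r" for i
  proof (cases "Suc i = r")
    case True
    have "odd i" using True r by auto
    then show ?thesis
      using tail True b[of i] b[of 0] r vs(2,3) nth[of i] nth_r i
      by (cases b) (auto simp: nb_step_def)
  next
    case False
    then have "Suc i < r" using i by simp
    then show ?thesis
      using red[of i] b[of i] b[of "Suc i"] nth[of i] nth[of "Suc i"] i
      by (auto simp: nb_step_def split: if_splits)
  qed
  have "set fs \<subseteq> arcs"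
    using E E[of 0] r by (auto simp: fs_def)
  moreover have "length fs = Suc r" by (simp add: fs_def)
  moreover have "fs ! 0 = (x, vs ! 1)" "fs ! r = (x, vs ! 1)"
    using nth[of 0] nth_r vs r by auto
  moreover have "E x (vs ! 1)" using E[of 0] vs r by simp
  ultimately have "fs \<in> nb_cycles r x"
    using step unfolding nb_cycles_def nb_paths_def by auto
  with es_alt show ?thesis by blast
qed

text \<open>Reversal is an involution, and the dropped last arc equals the first, so nothing is
  lost.\<close>

lemma inj_on_alternate:
  assumes "0 < r"
  shows "inj_on (alternate r b) (nb_cycles r x)"
proof (rule inj_onI)
  fix fs gs assume fg: "fs \<in> nb_cycles r x" "gs \<in> nb_cycles r x" "alternate r b fs = alternate r b gs"
  have *: "fs ! i = gs ! i" if "i < r" for i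
  proof -
    have "alternate r b fs ! i = alternate r b gs ! i" using fg by simp
    then show ?thesis using that by (simp add: alternate_def swap_eq_iff split: if_splits)
  qed
  have len: "length fs = Suc r" "length gs = Suc r" "fs ! r = fs ! 0" "gs ! r = gs ! 0"
    using fg by (auto simp: nb_cycles_def nb_paths_def)
  show "fs = gs"
    by (rule nth_equalityI) (use len * assms in \<open>auto simp: less_Suc_eq\<close>)
qed

text \<open>The factor 2 counts the two alternation patterns. Their images are disjoint: the first
  arc leaves \<open>x\<close> under one and enters \<open>x\<close> under the other, and there are
  no loops.\<close>

lemma N_alt_even:
  assumes r: "even r" "0 < r"
  shows "real (N_alt E x r) = 2 * (\<Sum>z\<in>nbrs x. nb r (x, z) (x, z))"
proof -
  let ?T = "alternate r True ` nb_cycles r x" and ?F = "alternate r False ` nb_cycles r x"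
  have "es \<in> ?T \<union> ?F" if "es \<in> reduced_alt_cycles E x r" for es
    using alternate_surj[OF r that] by (metis (full_types) UnI1 UnI2)
  then have "reduced_alt_cycles E x r = ?T \<union> ?F"
    using alternate_mem[OF r] by blast
  moreover have "?T \<inter> ?F = {}"
  proof -
    have "alternate r True fs \<noteq> alternate r False gs"
      if "fs \<in> nb_cycles r x" "gs \<in> nb_cycles r x" for fs gs
    proof -
      from that obtain z w where "fs ! 0 = (x, z)" "gs ! 0 = (x, w)" "E x w"
        by (auto simp: nb_cycles_def nb_paths_def)
      then have "alternate r True fs ! 0 = (x, z)" "alternate r False gs ! 0 = (w, x)" "w \<noteq> x"
        using r E_irrefl by (auto simp: alternate_def)
      then show ?thesis by force
    qed
    then show ?thesis by blast
  qed
  ultimately have "N_alt E x r = card ?T + card ?F"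
    unfolding N_alt_def by (simp add: card_Un_disjoint)
  also have "\<dots> = 2 * card (nb_cycles r x)"
    by (simp add: card_image inj_on_alternate[OF r(2)])
  finally show ?thesis by (simp add: card_nb_cycles)
qed

lemma N_alt_odd: "odd r \<Longrightarrow> N_alt E x r = 0"
  by (simp add: N_alt_def reduced_alt_cycles_def)

lemma finite_reduced_alt_cycles: "0 < r \<Longrightarrow> finite (reduced_alt_cycles E x r)"
proof (cases "even r")
  case True
  assume "0 < r"
  then have "reduced_alt_cycles E x r \<subseteq> (\<Union>b. alternate r b ` nb_cycles r x)"
    using alternate_surj[OF True] by blast
  then show ?thesis by (rule finite_subset) simp
qed (simp add: reduced_alt_cycles_def)

section \<open>Invariance of the cycle counts under graph automorphisms\<close>

lemma N_alt_automorphism_le: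
  assumes f: "bij_betw f {..<N} {..<N}" "\<And>a b. a < N \<Longrightarrow> b < N \<Longrightarrow> E a b \<longleftrightarrow> E (f a) (f b)"
    and r: "0 < r"
  shows "N_alt E x r \<le> N_alt E (f x) r"
  unfolding N_alt_def
proof (rule card_inj_on_le[where f = "map (map_prod f f)"])
  have inj: "inj_on f {..<N}" using f(1) by (rule bij_betw_imp_inj_on)
  then have inj2: "inj_on (map_prod f f) ({..<N} \<times> {..<N})" by (intro map_prod_inj_on)
  have mem: "es ! i \<in> {..<N} \<times> {..<N}" "length es = r"
    if "es \<in> reduced_alt_cycles E x r" "i < r" for es i
    using that E_less by (auto simp: reduced_alt_cycles_def alt_walk_def)
  have sub: "set es \<subseteq> {..<N} \<times> {..<N}" if "es \<in> reduced_alt_cycles E x r" for es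
    using mem[OF that] r by (metis in_set_conv_nth subsetI)
  show "inj_on (map (map_prod f f)) (reduced_alt_cycles E x r)"
  proof (rule inj_onI)
    fix es fs assume *: "es \<in> reduced_alt_cycles E x r" "fs \<in> reduced_alt_cycles E x r"
      "map (map_prod f f) es = map (map_prod f f) fs"
    have "inj_on (map_prod f f) (set es \<union> set fs)"
      using sub * by (intro inj_on_subset[OF inj2]) auto
    then show "es = fs" using *(3) by (simp add: inj_on_map_eq_map)
  qed
  show "map (map_prod f f) ` reduced_alt_cycles E x r \<subseteq> reduced_alt_cycles E (f x) r"
  proof
    fix gs assume "gs \<in> map (map_prod f f) ` reduced_alt_cycles E x r"
    then obtain es where gs: "gs = map (map_prod f f) es" and es: "es \<in> reduced_alt_cycles E x r"
      by blast
    have len: "length es = r" using mem[OF es] r by blast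
    have ne: "gs ! i \<noteq> gs ! j" if "es ! i \<noteq> es ! j" "i < r" "j < r" for i j
      using that mem(1)[OF es] inj_onD[OF inj2] by (simp add: gs len) blast
    from es obtain vs where vs: "alt_walk E r es vs" "vs ! 0 = x" "vs ! r = x"
      by (auto simp: reduced_alt_cycles_def)
    have "alt_walk E r gs (map f vs)"
    proof -
      have "E (f (vs ! i)) (f (vs ! (i + 1)))" if "i < r" for i
        using vs(1) that f(2) E_less unfolding alt_walk_def by blast
      then show ?thesis
        using vs(1) by (auto simp: alt_walk_def gs)
    qed
    moreover have "map f vs ! 0 = f x" "map f vs ! r = f x"
      using vs by (auto simp: alt_walk_def)
    ultimately show "gs \<in> reduced_alt_cycles E (f x) r"
      using es ne r unfolding reduced_alt_cycles_def by auto
  qed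
qed (use finite_reduced_alt_cycles r in auto)

text \<open>Automorphisms taking \<open>x\<close> to \<open>y\<close> and \<open>y\<close> to
  \<open>x\<close> give the two inequalities.\<close>

lemma N_alt_vertex_transitive:
  assumes "vertex_transitive N E" "x < N" "y < N" "0 < r"
  shows "N_alt E x r = N_alt E y r"
proof -
  have le: "N_alt E u r \<le> N_alt E v r" if uv: "u < N" "v < N" for u v
  proof -
    from assms(1) uv obtain f where "bij_betw f {..<N} {..<N}"
      "\<forall>a<N. \<forall>b<N. E a b \<longleftrightarrow> E (f a) (f b)" "f u = v"
      unfolding vertex_transitive_def by blast
    with N_alt_automorphism_le[of f r u] assms(4) show ?thesis by blast
  qed
  show ?thesis using le[of x y] le[of y x] assms(2,3) by simp
qed

end

subsection \<open>Logarithmic series of Lucas sequences\<close>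

text \<open>The Lucas sequence \<open>V_k(x, q)\<close>: the scalar counterpart of
  \<open>cheb\<close>, with an eigenvalue in place of the adjacency matrix.\<close>

fun lucas :: "real \<Rightarrow> real \<Rightarrow> nat \<Rightarrow> real" where
  "lucas q x 0 = 2"
| "lucas q x (Suc 0) = x"
| "lucas q x (Suc (Suc k)) = x * lucas q x (Suc k) - q * lucas q x k"

lemma lucas_eq_power_sum:
  fixes \<alpha> \<beta> :: complex
  assumes "\<alpha> + \<beta> = of_real x" "\<alpha> * \<beta> = of_real q"
  shows "of_real (lucas q x k) = \<alpha> ^ k + \<beta> ^ k"
proof (induction k rule: induct_nat_012)
  case (ge2 k)
  have "of_real (lucas q x (Suc (Suc k)))
      = (\<alpha> + \<beta>) * (\<alpha> ^ Suc k + \<beta> ^ Suc k) - \<alpha> * \<beta> * (\<alpha> ^ k + \<beta> ^ k)"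
    by (simp add: ge2.IH assms del: power_Suc)
  also have "\<dots> = \<alpha> ^ Suc (Suc k) + \<beta> ^ Suc (Suc k)"
    by (simp add: algebra_simps)
  finally show ?case .
qed (use assms in simp_all)

text \<open>A real root satisfies \<open>(\<bar>\<alpha>\<bar> - 1) * (\<bar>\<alpha>\<bar> - q)
  \<le> 0\<close>; a nonreal one has squared norm \<open>q\<close>, which is at most
  \<open>q\<^sup>2\<close>.\<close>

lemma norm_root_le:
  fixes \<alpha> :: complex and q x :: real
  assumes root: "\<alpha>\<^sup>2 - of_real x * \<alpha> + of_real q = 0" and q: "1 \<le> q" and x: "\<bar>x\<bar> \<le> q + 1"
  shows "norm \<alpha> \<le> q"
proof -
  have Re: "(Re \<alpha>)\<^sup>2 - (Im \<alpha>)\<^sup>2 - x * Re \<alpha> + q = 0"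
    using arg_cong[OF root, of Re] by (simp add: power2_eq_square)
  have Im: "Im \<alpha> * (2 * Re \<alpha> - x) = 0"
    using arg_cong[OF root, of Im] by (simp add: power2_eq_square algebra_simps)
  show ?thesis
  proof (cases "Im \<alpha> = 0")
    case True
    then have norm: "norm \<alpha> = \<bar>Re \<alpha>\<bar>" by (simp add: cmod_def)
    have "\<bar>Re \<alpha>\<bar> ^ 2 + q = x * Re \<alpha>" using Re True by simp
    also have "\<dots> \<le> \<bar>x\<bar> * \<bar>Re \<alpha>\<bar>" by (metis abs_ge_self abs_mult)
    also have "\<dots> \<le> (q + 1) * \<bar>Re \<alpha>\<bar>" using x by (intro mult_right_mono) auto
    finally have "(\<bar>Re \<alpha>\<bar> - 1) * (\<bar>Re \<alpha>\<bar> - q) \<le> 0"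
      by (simp add: algebra_simps power2_eq_square)
    then show ?thesis using q norm by (auto simp: mult_le_0_iff)
  next
    case False
    then have "x = 2 * Re \<alpha>" using Im by simp
    with Re have "(norm \<alpha>)\<^sup>2 = q" by (simp add: cmod_power2, simp add: power2_eq_square)
    moreover have "q \<le> q\<^sup>2" using q by (simp add: power2_eq_square)
    ultimately have "(norm \<alpha>)\<^sup>2 \<le> q\<^sup>2" by linarith
    then show ?thesis by (rule power2_le_imp_le) (use q in linarith)
  qed
qed

lemma Ln_one_minus_sums:
  fixes z :: complex
  assumes "norm z < 1"
  shows "(\<lambda>k. z ^ Suc k / of_nat (Suc k)) sums - Ln (1 - z)"
proof -
  have "(\<lambda>n. (-1) ^ Suc n / of_nat n * (- z) ^ n) sums Ln (1 + - z)"
    by (rule Ln_series) (use assms in simp)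
  then have "(\<lambda>n. - ((-1) ^ Suc n / of_nat n * (- z) ^ n)) sums - Ln (1 - z)"
    using sums_minus by fastforce
  moreover have "- ((-1) ^ Suc n / of_nat n * (- z) ^ n) = z ^ n / of_nat n" for n
    by (simp add: power_minus[of z])
  ultimately have "(\<lambda>n. z ^ n / of_nat n) sums - Ln (1 - z)" by (simp only:)
  \<comment> \<open>The shift drops the term at index 0, which is \<open>z ^ 0 / 0\<close> and hence
    0.\<close>
  then show ?thesis by (subst sums_Suc_iff) simp
qed

text \<open>The extreme case is \<open>x * t = (q + 1) * \<bar>t\<bar>\<close>, where the quadratic
  factors as \<open>(1 - \<bar>t\<bar>) * (1 - q * \<bar>t\<bar>)\<close> with both factors
  positive.\<close>

lemma char_quadratic_pos:
  fixes q x t :: real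
  assumes "1 \<le> q" "\<bar>x\<bar> \<le> q + 1" "\<bar>t\<bar> < 1 / q"
  shows "1 - x * t + q * t\<^sup>2 > 0"
proof -
  have "q * \<bar>t\<bar> < 1" using assms by (simp add: field_simps)
  moreover have "\<bar>t\<bar> \<le> q * \<bar>t\<bar>" using assms by (simp add: mult_le_cancel_right1)
  ultimately have "0 < (1 - \<bar>t\<bar>) * (1 - q * \<bar>t\<bar>)" by simp
  also have "\<dots> = 1 - (q + 1) * \<bar>t\<bar> + q * t\<^sup>2"
    by (simp add: algebra_simps power2_eq_square)
  also have "\<dots> \<le> 1 - x * t + q * t\<^sup>2"
  proof -
    have "x * t \<le> \<bar>x\<bar> * \<bar>t\<bar>" by (metis abs_ge_self abs_mult)
    also have "\<dots> \<le> (q + 1) * \<bar>t\<bar>" using assms by (intro mult_right_mono) auto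
    finally show ?thesis by simp
  qed
  finally show ?thesis .
qed

text \<open>The quadratic factors as \<open>(1 - \<alpha> * t) * (1 - \<beta> * t)\<close> with
  possibly nonreal \<alpha> and \<beta>. Add the two complex logarithm series and take real parts,
  using that the real part of \<open>Ln z\<close> is \<open>ln (norm z)\<close>.\<close>

lemma lucas_log_sums:
  fixes q x t :: real
  assumes q: "1 \<le> q" and x: "\<bar>x\<bar> \<le> q + 1" and t: "\<bar>t\<bar> < 1 / q"
  shows "(\<lambda>k. lucas q x (Suc k) * t ^ Suc k / real (Suc k)) sums - ln (1 - x * t + q * t\<^sup>2)"
proof -
  \<comment> \<open>A complex square root of the discriminant of the quadratic with root sum
    \<open>x\<close> and root product \<open>q\<close>.\<close>
  define s where "s = csqrt (of_real (x\<^sup>2 - 4 * q))"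
  define \<alpha> \<beta> where "\<alpha> = (of_real x + s) / 2" and "\<beta> = (of_real x - s) / 2"
  have s2: "s * s = of_real (x\<^sup>2 - 4 * q)"
    unfolding s_def by (metis power2_csqrt power2_eq_square)
  have sum: "\<alpha> + \<beta> = of_real x" by (simp add: \<alpha>_def \<beta>_def field_simps)
  have prod: "\<alpha> * \<beta> = of_real q"
    using s2 by (simp add: \<alpha>_def \<beta>_def algebra_simps power2_eq_square)
  have root: "\<gamma>\<^sup>2 - of_real x * \<gamma> + of_real q = 0" if "\<gamma> = \<alpha> \<or> \<gamma> = \<beta>" for \<gamma>
    using that unfolding sum[symmetric] prod[symmetric]
    by (auto simp: algebra_simps power2_eq_square)
  have small: "norm (\<gamma> * of_real t) < 1" if "\<gamma> = \<alpha> \<or> \<gamma> = \<beta>" for \<gamma>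
  proof -
    have "norm (\<gamma> * of_real t) \<le> q * \<bar>t\<bar>"
      using norm_root_le[OF root[OF that] q x] by (simp add: norm_mult mult_right_mono)
    also have "\<dots> < 1" using t q by (simp add: field_simps)
    finally show ?thesis .
  qed
  have ne: "1 - \<gamma> * of_real t \<noteq> 0" if "\<gamma> = \<alpha> \<or> \<gamma> = \<beta>" for \<gamma>
    using small[OF that] by auto
  have "(\<lambda>k. Re ((\<alpha> * of_real t) ^ Suc k / of_nat (Suc k) + (\<beta> * of_real t) ^ Suc k / of_nat (Suc k)))
      sums Re (- Ln (1 - \<alpha> * of_real t) + - Ln (1 - \<beta> * of_real t))"
    using small by (intro sums_Re sums_add Ln_one_minus_sums) auto
  also have "(\<lambda>k. Re ((\<alpha> * of_real t) ^ Suc k / of_nat (Suc k) + (\<beta> * of_real t) ^ Suc k / of_nat (Suc k)))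
      = (\<lambda>k. lucas q x (Suc k) * t ^ Suc k / real (Suc k))"
  proof
    fix k
    have "(\<alpha> * of_real t) ^ Suc k / of_nat (Suc k) + (\<beta> * of_real t) ^ Suc k / of_nat (Suc k)
        = (\<alpha> ^ Suc k + \<beta> ^ Suc k) * of_real t ^ Suc k / of_nat (Suc k)"
      by (simp only: power_mult_distrib distrib_right add_divide_distrib)
    also have "\<dots> = of_real (lucas q x (Suc k) * t ^ Suc k / real (Suc k))"
      unfolding lucas_eq_power_sum[OF sum prod, symmetric] by simp
    finally show "Re ((\<alpha> * of_real t) ^ Suc k / of_nat (Suc k) + (\<beta> * of_real t) ^ Suc k / of_nat (Suc k))
        = lucas q x (Suc k) * t ^ Suc k / real (Suc k)"
      by (simp only: Re_complex_of_real)
  qed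
  also have "Re (- Ln (1 - \<alpha> * of_real t) + - Ln (1 - \<beta> * of_real t))
      = - (ln (norm (1 - \<alpha> * of_real t)) + ln (norm (1 - \<beta> * of_real t)))"
    using ne by simp
  also have "\<dots> = - ln (norm ((1 - \<alpha> * of_real t) * (1 - \<beta> * of_real t)))"
    using ne by (simp add: norm_mult ln_mult)
  also have "(1 - \<alpha> * of_real t) * (1 - \<beta> * of_real t)
      = 1 - (\<alpha> + \<beta>) * of_real t + \<alpha> * \<beta> * of_real t ^ 2"
    by (simp add: algebra_simps power2_eq_square)
  also have "\<dots> = of_real (1 - x * t + q * t\<^sup>2)"
    by (simp add: sum prod)
  also have "norm (complex_of_real (1 - x * t + q * t\<^sup>2)) = 1 - x * t + q * t\<^sup>2"
    unfolding norm_of_real using char_quadratic_pos[OF assms] by (rule abs_of_pos)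
  finally show ?thesis .
qed

text \<open>Adding the series at \<open>t\<close> and at \<open>- t\<close> cancels the odd terms,
  while the two quadratics multiply to a difference of squares.\<close>

lemma lucas_even_log_sums:
  fixes q x t :: real
  assumes q: "1 \<le> q" and x: "\<bar>x\<bar> \<le> q + 1" and t: "\<bar>t\<bar> < 1 / q"
  shows "(\<lambda>k. lucas q x (Suc k) * (t ^ Suc k + (- t) ^ Suc k) / real (Suc k))
           sums - ln ((1 + q * t\<^sup>2)\<^sup>2 - x\<^sup>2 * t\<^sup>2)"
proof -
  have p: "1 - x * t + q * t\<^sup>2 > 0" "1 - x * (- t) + q * (- t)\<^sup>2 > 0"
    using char_quadratic_pos[OF q x, of t] char_quadratic_pos[OF q x, of "- t"] t by simp_all
  have "(\<lambda>k. lucas q x (Suc k) * t ^ Suc k / real (Suc k) + lucas q x (Suc k) * (- t) ^ Suc k / real (Suc k))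
      sums (- ln (1 - x * t + q * t\<^sup>2) + - ln (1 - x * (- t) + q * (- t)\<^sup>2))"
    using t by (intro sums_add lucas_log_sums q x) auto
  also have "- ln (1 - x * t + q * t\<^sup>2) + - ln (1 - x * (- t) + q * (- t)\<^sup>2)
      = - ln ((1 - x * t + q * t\<^sup>2) * (1 - x * (- t) + q * (- t)\<^sup>2))"
    using ln_mult_pos[OF p] by simp
  also have "(1 - x * t + q * t\<^sup>2) * (1 - x * (- t) + q * (- t)\<^sup>2) = (1 + q * t\<^sup>2)\<^sup>2 - x\<^sup>2 * t\<^sup>2"
    by (simp add: algebra_simps power2_eq_square)
  finally show ?thesis by (simp only: distrib_left add_divide_distrib)
qed

lemma even_power_log_sums:
  fixes t :: real
  assumes t: "\<bar>t\<bar> < 1"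
  shows "(\<lambda>k. (t ^ Suc k + (- t) ^ Suc k) / real (Suc k)) sums - ln (1 - t\<^sup>2)"
proof -
  have *: "(\<lambda>k. s ^ Suc k / real (Suc k)) sums - ln (1 - s)" if "\<bar>s\<bar> < 1" for s :: real
  proof -
    have "(\<lambda>k. Re (of_real s ^ Suc k / of_nat (Suc k))) sums Re (- Ln (1 - of_real s))"
      using that by (intro sums_Re Ln_one_minus_sums) simp
    also have "1 - complex_of_real s = of_real (1 - s)" by simp
    also have "(\<lambda>k. Re (of_real s ^ Suc k / of_nat (Suc k))) = (\<lambda>k. s ^ Suc k / real (Suc k))"
    proof
      fix k
      have "complex_of_real s ^ Suc k / of_nat (Suc k) = of_real (s ^ Suc k / real (Suc k))" by simp
      then show "Re (of_real s ^ Suc k / of_nat (Suc k)) = s ^ Suc k / real (Suc k)"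
        by (simp only: Re_complex_of_real)
    qed
    finally show ?thesis using that by (simp add: Ln_of_real del: of_real_diff)
  qed
  have "(\<lambda>k. t ^ Suc k / real (Suc k) + (- t) ^ Suc k / real (Suc k)) sums (- ln (1 - t) + - ln (1 - - t))"
    using t by (intro sums_add *) auto
  also have "- ln (1 - t) + - ln (1 - - t) = - ln (1 - t\<^sup>2)"
  proof -
    have "ln ((1 - t) * (1 + t)) = ln (1 - t) + ln (1 + t)" using t by (intro ln_mult_pos) auto
    then show ?thesis by (simp add: algebra_simps power2_eq_square)
  qed
  finally show ?thesis by (simp only: add_divide_distrib)
qed

subsection \<open>Traces and spectra of real symmetric matrices\<close>

lemma index_mult_mat_sum:
  assumes "A \<in> carrier_mat n n" "B \<in> carrier_mat n n" "i < n" "j < n"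
  shows "(A * B) $$ (i, j) = (\<Sum>k<n. A $$ (i, k) * B $$ (k, j))"
  using assms by (auto simp: scalar_prod_def atLeast0LessThan intro!: sum.cong)

lemma trace_mult_commute:
  fixes A B :: "'a :: comm_semiring_0 mat"
  assumes "A \<in> carrier_mat n n" "B \<in> carrier_mat n n"
  shows "(\<Sum>i<n. (A * B) $$ (i, i)) = (\<Sum>i<n. (B * A) $$ (i, i))"
proof -
  have "(\<Sum>i<n. (A * B) $$ (i, i)) = (\<Sum>i<n. \<Sum>k<n. A $$ (i, k) * B $$ (k, i))"
    using assms by (intro sum.cong refl index_mult_mat_sum) auto
  also have "\<dots> = (\<Sum>k<n. \<Sum>i<n. B $$ (k, i) * A $$ (i, k))"
    by (subst sum.swap) (simp add: mult.commute)
  also have "\<dots> = (\<Sum>i<n. (B * A) $$ (i, i))"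
    using assms by (intro sum.cong refl index_mult_mat_sum[symmetric]) auto
  finally show ?thesis .
qed

lemma trace_similar:
  fixes G P Q :: "'a :: comm_ring_1 mat"
  assumes "G \<in> carrier_mat n n" "P \<in> carrier_mat n n" "Q \<in> carrier_mat n n" "Q * P = 1\<^sub>m n"
  shows "(\<Sum>i<n. (P * G * Q) $$ (i, i)) = (\<Sum>i<n. G $$ (i, i))"
proof -
  have "(\<Sum>i<n. (P * G * Q) $$ (i, i)) = (\<Sum>i<n. (Q * (P * G)) $$ (i, i))"
    using assms by (intro trace_mult_commute) auto
  also have "Q * (P * G) = Q * P * G"
    by (rule assoc_mult_mat[symmetric, OF assms(3,2,1)])
  finally show ?thesis using assms by (simp del: assoc_mult_mat)
qed

lemma upper_triangular_mult:
  fixes A B :: "'a :: semiring_0 mat"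
  assumes "A \<in> carrier_mat n n" "B \<in> carrier_mat n n" "upper_triangular A" "upper_triangular B"
  shows "upper_triangular (A * B)"
    and "i < n \<Longrightarrow> (A * B) $$ (i, i) = A $$ (i, i) * B $$ (i, i)"
proof -
  have A0: "A $$ (i, j) = 0" if "j < i" "i < n" for i j
    using assms that by (auto simp: upper_triangular_def)
  have B0: "B $$ (i, j) = 0" if "j < i" "i < n" for i j
    using assms that by (auto simp: upper_triangular_def)
  have "(A * B) $$ (i, j) = 0" if ij: "j < i" "i < n" for i j
  proof -
    have "A $$ (i, k) * B $$ (k, j) = 0" if "k < n" for k
      using A0[of k i] B0[of j k] ij that by (cases "k < i") auto
    then show ?thesis using assms ij by (simp add: index_mult_mat_sum del: index_mult_mat)
  qed
  then show "upper_triangular (A * B)" using assms by (auto simp: upper_triangular_def)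
  assume i: "i < n"
  have "A $$ (i, k) * B $$ (k, i) = (if k = i then A $$ (i, i) * B $$ (i, i) else 0)" if "k < n" for k
    using A0[of k i] B0[of i k] i that by (cases k i rule: linorder_cases) auto
  then have "(A * B) $$ (i, i) = (\<Sum>k<n. if k = i then A $$ (i, i) * B $$ (i, i) else 0)"
    unfolding index_mult_mat_sum[OF assms(1,2) i i] by (intro sum.cong refl) auto
  then show "(A * B) $$ (i, i) = A $$ (i, i) * B $$ (i, i)" using i by simp
qed

text \<open>\<open>F k\<close> is a polynomial in \<open>c\<close> times \<open>A\<close>, so one
  Schur triangularization of \<open>A\<close> makes all \<open>F k\<close> upper triangular at once.
  Diagonals of triangular matrices multiply entrywise and therefore follow the scalar recursion
  \<open>lucas\<close>; conjugation preserves the trace.\<close>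

lemma lucas_trace:
  fixes A :: "real mat" and F :: "nat \<Rightarrow> nat \<Rightarrow> nat \<Rightarrow> real"
  assumes A: "A \<in> carrier_mat n n" and es: "char_poly A = (\<Prod>a\<leftarrow>es. [:- a, 1:])"
    and F0: "\<And>x y. x < n \<Longrightarrow> y < n \<Longrightarrow> F 0 x y = 2 * of_bool (x = y)"
    and F1: "\<And>x y. x < n \<Longrightarrow> y < n \<Longrightarrow> F (Suc 0) x y = c * A $$ (x, y)"
    and F2: "\<And>k x y. x < n \<Longrightarrow> y < n \<Longrightarrow>
      F (Suc (Suc k)) x y = c * (\<Sum>z<n. F (Suc k) x z * A $$ (z, y)) - q * F k x y"
  shows "(\<Sum>x<n. F k x x) = (\<Sum>a\<leftarrow>es. lucas q (c * a) k)"
proof -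
  obtain B P Q where schur: "schur_decomposition A es = (B, P, Q)" by (cases "schur_decomposition A es")
  from schur_decomposition[OF A es schur]
  have sim: "similar_mat_wit A B P Q" and ut: "upper_triangular B" and diag: "diag_mat B = es" by auto
  note PQ = similar_mat_witD2[OF A sim]
  define M where "M k = mat n n (\<lambda>(x, y). F k x y)" for k
  have M: "M k \<in> carrier_mat n n" for k by (simp add: M_def)
  have M0: "M 0 = 2 \<cdot>\<^sub>m 1\<^sub>m n" by (rule eq_matI) (auto simp: M_def F0)
  have M1: "M (Suc 0) = c \<cdot>\<^sub>m A" using A by (intro eq_matI) (auto simp: M_def F1)
  have M2: "M (Suc (Suc k)) = c \<cdot>\<^sub>m (M (Suc k) * A) - q \<cdot>\<^sub>m M k" for k
  proof (rule eq_matI)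
    fix i j assume "i < dim_row (c \<cdot>\<^sub>m (M (Suc k) * A) - q \<cdot>\<^sub>m M k)"
      "j < dim_col (c \<cdot>\<^sub>m (M (Suc k) * A) - q \<cdot>\<^sub>m M k)"
    then have ij: "i < n" "j < n" using A M by (auto simp: M_def)
    have "(M (Suc k) * A) $$ (i, j) = (\<Sum>z<n. F (Suc k) i z * A $$ (z, j))"
      unfolding index_mult_mat_sum[OF M A ij] using ij by (simp add: M_def)
    then show "M (Suc (Suc k)) $$ (i, j) = (c \<cdot>\<^sub>m (M (Suc k) * A) - q \<cdot>\<^sub>m M k) $$ (i, j)"
      using ij A M[of k] M[of "Suc k"]
      by (simp add: F2 M_def[of "Suc (Suc k)"] del: index_mult_mat(1)) (simp add: M_def)
  qed (use A in \<open>auto simp: M_def\<close>)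
  have key: "\<exists>G. G \<in> carrier_mat n n \<and> upper_triangular G \<and> M k = P * G * Q \<and>
    (\<forall>i<n. G $$ (i, i) = lucas q (c * B $$ (i, i)) k)" for k
  proof (induction k rule: induct_nat_012)
    case 0
    have "M 0 = P * (2 \<cdot>\<^sub>m 1\<^sub>m n) * Q"
      unfolding M0 using PQ
      by (simp add: mult_smult_distrib[of _ n n _ n] mult_smult_assoc_mat[of _ n n _ n])
    then show ?case by (intro exI[of _ "2 \<cdot>\<^sub>m 1\<^sub>m n"]) (auto simp: upper_triangular_def)
  next
    case 1
    have "M (Suc 0) = P * (c \<cdot>\<^sub>m B) * Q"
      unfolding M1 PQ(3) using PQ(5-7)
      by (simp add: mult_smult_distrib[of _ n n _ n] mult_smult_assoc_mat[of _ n n _ n])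
    then show ?case
      using PQ ut by (intro exI[of _ "c \<cdot>\<^sub>m B"]) (auto simp: upper_triangular_def)
  next
    case (ge2 k)
    then obtain G H where G: "G \<in> carrier_mat n n" "upper_triangular G" "M k = P * G * Q"
        "\<And>i. i < n \<Longrightarrow> G $$ (i, i) = lucas q (c * B $$ (i, i)) k"
      and H: "H \<in> carrier_mat n n" "upper_triangular H" "M (Suc k) = P * H * Q"
        "\<And>i. i < n \<Longrightarrow> H $$ (i, i) = lucas q (c * B $$ (i, i)) (Suc k)"
      by blast
    define X where "X = H * B"
    let ?K = "c \<cdot>\<^sub>m X - q \<cdot>\<^sub>m G"
    have HB: "X \<in> carrier_mat n n" "upper_triangular X"
        "\<And>i. i < n \<Longrightarrow> X $$ (i, i) = H $$ (i, i) * B $$ (i, i)"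
      unfolding X_def using upper_triangular_mult[OF H(1) PQ(5) H(2) ut] H(1) PQ(5) by auto
    have K: "?K \<in> carrier_mat n n" using HB G by auto
    have utK: "upper_triangular ?K"
      using HB(1,2) G(1,2) by (auto simp: upper_triangular_def)
    have diagK: "?K $$ (i, i) = lucas q (c * B $$ (i, i)) (Suc (Suc k))" if "i < n" for i
      using HB(1,3) G(1,4) H(4) that by simp
    \<comment> \<open>The inner \<open>Q * P\<close> is the identity, so the product stays
      conjugated by the same pair.\<close>
    have "M (Suc k) * A = P * H * (Q * P) * B * Q"
      unfolding H(3) PQ(3) using H(1) PQ(5-7) by (simp add: assoc_mult_mat[of _ n n _ n _ n])
    also have "\<dots> = P * (H * B) * Q"
      using H(1) PQ by (simp add: assoc_mult_mat[of _ n n _ n _ n])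
    finally have MA: "M (Suc k) * A = P * X * Q" unfolding X_def .
    have "P * ?K * Q = (P * (c \<cdot>\<^sub>m X) - P * (q \<cdot>\<^sub>m G)) * Q"
      using HB(1) G(1) PQ(6) by (subst mult_minus_distrib_mat[of _ n n _ n]) auto
    also have "\<dots> = P * (c \<cdot>\<^sub>m X) * Q - P * (q \<cdot>\<^sub>m G) * Q"
      using HB(1) G(1) PQ(6,7) by (subst minus_mult_distrib_mat[of _ n n _ _ n]) auto
    also have "P * (c \<cdot>\<^sub>m X) * Q = c \<cdot>\<^sub>m (P * X * Q)"
      using HB(1) PQ(6,7)
      by (simp add: mult_smult_distrib[of _ n n _ n] mult_smult_assoc_mat[of _ n n _ n])
    also have "P * (q \<cdot>\<^sub>m G) * Q = q \<cdot>\<^sub>m (P * G * Q)"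
      using G(1) PQ(6,7)
      by (simp add: mult_smult_distrib[of _ n n _ n] mult_smult_assoc_mat[of _ n n _ n])
    finally have "M (Suc (Suc k)) = P * ?K * Q"
      unfolding M2 MA G(3) by simp
    then show ?case using K utK diagK by blast
  qed
  then obtain G where G: "G \<in> carrier_mat n n" "M k = P * G * Q"
    "\<And>i. i < n \<Longrightarrow> G $$ (i, i) = lucas q (c * B $$ (i, i)) k" by blast
  have "(\<Sum>x<n. F k x x) = (\<Sum>x<n. (P * G * Q) $$ (x, x))"
    unfolding G(2)[symmetric] by (simp add: M_def)
  also have "\<dots> = (\<Sum>x<n. lucas q (c * B $$ (x, x)) k)"
    using trace_similar[OF G(1) PQ(6,7,2)] G(3) by simp
  also have "\<dots> = (\<Sum>a\<leftarrow>diag_mat B. lucas q (c * a) k)"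
    using PQ(5) by (simp add: diag_mat_def interv_sum_list_conv_sum_set_nat atLeast0LessThan o_def)
  finally show ?thesis by (simp add: diag)
qed

section \<open>Reality, multiplicity and size of eigenvalues\<close>

lemma nonzero_vec_index:
  assumes "v \<in> carrier_vec n" "v \<noteq> 0\<^sub>v n"
  shows "\<exists>i<n. vec_index v i \<noteq> 0"
proof (rule ccontr)
  assume "\<not> ?thesis"
  then have "v = 0\<^sub>v n" using assms(1) by (intro eq_vecI) auto
  with assms(2) show False by simp
qed

text \<open>The Hermitian form \<open>S\<close> of the eigenvector is real by symmetry of
  \<open>A\<close>, and it equals \<open>k\<close> times a positive real, the squared norm.\<close>

lemma symmetric_complex_eigenvalue_real:
  fixes A :: "real mat"
  assumes A: "A \<in> carrier_mat n n" and sym: "\<And>i j. i < n \<Longrightarrow> j < n \<Longrightarrow> A $$ (i, j) = A $$ (j, i)"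
    and ev: "eigenvalue (map_mat complex_of_real A) k"
  shows "k \<in> \<real>"
proof -
  from ev A obtain v where v: "v \<in> carrier_vec n" "v \<noteq> 0\<^sub>v n"
      "map_mat complex_of_real A *\<^sub>v v = k \<cdot>\<^sub>v v"
    unfolding eigenvalue_def eigenvector_def by auto
  define w where "w i = vec_index v i" for i
  have eq: "(\<Sum>j<n. of_real (A $$ (i, j)) * w j) = k * w i" if "i < n" for i
  proof -
    have "vec_index (map_mat complex_of_real A *\<^sub>v v) i = vec_index (k \<cdot>\<^sub>v v) i" by (simp add: v(3))
    then show ?thesis using that A v(1)
      by (simp add: scalar_prod_def atLeast0LessThan w_def)
  qed
  define S where "S = (\<Sum>i<n. \<Sum>j<n. of_real (A $$ (i, j)) * w j * cnj (w i))"
  have S: "S = k * of_real (\<Sum>i<n. (norm (w i))\<^sup>2)"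
  proof -
    have "S = (\<Sum>i<n. (\<Sum>j<n. of_real (A $$ (i, j)) * w j) * cnj (w i))"
      by (simp add: S_def sum_distrib_right)
    also have "\<dots> = (\<Sum>i<n. k * of_real ((norm (w i))\<^sup>2))"
      by (intro sum.cong refl) (simp add: eq mult.assoc complex_norm_square[symmetric] del: of_real_power)
    finally show ?thesis by (simp add: sum_distrib_left)
  qed
  have "cnj S = (\<Sum>i<n. \<Sum>j<n. of_real (A $$ (i, j)) * w i * cnj (w j))"
    by (simp add: S_def mult_ac)
  also have "\<dots> = (\<Sum>j<n. \<Sum>i<n. of_real (A $$ (j, i)) * w i * cnj (w j))"
    by (subst sum.swap, intro sum.cong refl) (simp add: sym)
  also have "\<dots> = S" by (simp add: S_def)
  finally have "S \<in> \<real>" by (simp add: Reals_cnj_iff)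
  obtain i where i: "i < n" "w i \<noteq> 0"
    using nonzero_vec_index[OF v(1,2)] by (auto simp: w_def)
  have "(\<Sum>i<n. (norm (w i))\<^sup>2) > 0"
    by (rule sum_pos2[of _ i]) (use i in auto)
  then have "k = S / of_real (\<Sum>i<n. (norm (w i))\<^sup>2)"
    unfolding S by (simp del: of_real_sum)
  then show ?thesis using \<open>S \<in> \<real>\<close> by (metis Reals_divide Reals_of_real)
qed

text \<open>The polynomial splits over the complex numbers with real roots only; the splitting
  descends because the embedding of real polynomials into complex ones is injective.\<close>

lemma symmetric_char_poly_splits:
  fixes A :: "real mat"
  assumes A: "A \<in> carrier_mat n n" and sym: "\<And>i j. i < n \<Longrightarrow> j < n \<Longrightarrow> A $$ (i, j) = A $$ (j, i)"
  shows "\<exists>es. char_poly A = (\<Prod>a\<leftarrow>es. [:- a, 1:])"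
proof -
  let ?A = "map_mat complex_of_real A"
  have cA: "?A \<in> carrier_mat n n" using A by simp
  from char_poly_factorized[OF cA] obtain as where as: "char_poly ?A = (\<Prod>a\<leftarrow>as. [:- a, 1:])" by blast
  have real: "a \<in> \<real>" if "a \<in> set as" for a
  proof (rule symmetric_complex_eigenvalue_real[OF A sym])
    have "poly (char_poly ?A) a = 0"
      unfolding as using that by (simp add: poly_prod_list prod_list_zero_iff)
    then show "eigenvalue ?A a" using eigenvalue_root_char_poly[OF cA] by simp
  qed
  interpret h: map_poly_inj_comm_ring_hom complex_of_real ..
  have "map_poly complex_of_real (\<Prod>a\<leftarrow>map Re as. [:- a, 1:]) = (\<Prod>a\<leftarrow>as. [:- a, 1:])"
    using real
  proof (induction as)
    case (Cons a as)
    then obtain r where "a = of_real r" by (auto elim: Reals_cases)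
    with Cons show ?case by (simp add: h.hom_mult map_poly_pCons o_def del: mult_pCons_left)
  qed simp
  also have "\<dots> = map_poly complex_of_real (char_poly A)"
    by (simp add: as[symmetric] of_real_hom.char_poly_hom[OF A])
  finally have "char_poly A = (\<Prod>a\<leftarrow>map Re as. [:- a, 1:])"
    using h.injectivity by metis
  then show ?thesis by blast
qed

lemma sum_mset_image_eq_sum_count:
  fixes f :: "'a \<Rightarrow> 'b :: semiring_1"
  shows "(\<Sum>x\<in>#M. f x) = (\<Sum>x\<in>set_mset M. of_nat (count M x) * f x)"
proof (induction M)
  case (add y M)
  have "(\<Sum>x\<in>set_mset (add_mset y M). of_nat (count (add_mset y M) x) * f x)
      = (\<Sum>x\<in>insert y (set_mset M). of_nat (count M x) * f x + (if x = y then f x else 0))"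
    by (intro sum.cong) (auto simp: algebra_simps)
  also have "\<dots> = (\<Sum>x\<in>insert y (set_mset M). of_nat (count M x) * f x) + f y"
    by (simp add: sum.distrib)
  also have "(\<Sum>x\<in>insert y (set_mset M). of_nat (count M x) * f x)
      = (\<Sum>x\<in>set_mset M. of_nat (count M x) * f x)"
    by (intro sum.mono_neutral_right) (auto simp: not_in_iff)
  finally show ?case using add by (simp add: add.commute)
qed simp

text \<open>The definition weights distinct roots by their order; the root multiset of the split
  polynomial is \<open>mset es\<close>, which repeats each root that often.\<close>

lemma spectral_integral_eq:
  assumes "char_poly A = (\<Prod>a\<leftarrow>es. [:- a, 1:])"
  shows "spectral_integral A f = (\<Sum>a\<leftarrow>es. f a) / real (dim_row A)"
proof -
  have nz: "char_poly A \<noteq> 0" unfolding assms by (auto simp: prod_list_zero_iff)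
  have roots: "proots (char_poly A) = mset es"
    unfolding assms
  proof (induction es)
    case (Cons a es)
    have "(\<Prod>a\<leftarrow>es. [:- a, 1:]) \<noteq> 0" by (auto simp: prod_list_zero_iff)
    then show ?case using Cons by (simp add: proots_mult del: mult_pCons_left)
  qed simp
  have "(\<Sum>a\<leftarrow>es. f a) = (\<Sum>a\<in>#proots (char_poly A). f a)"
    unfolding roots by (metis mset_map sum_mset_sum_list)
  also have "\<dots> = (\<Sum>x\<in>{y. poly (char_poly A) y = 0}. real (Polynomial.order x (char_poly A)) * f x)"
    using nz by (simp add: sum_mset_image_eq_sum_count)
  finally show ?thesis by (simp add: spectral_integral_def)
qed

text \<open>Read the eigenvector equation in a coordinate of maximal absolute value.\<close>

lemma abs_eigenvalue_le:
  fixes A :: "real mat"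
  assumes A: "A \<in> carrier_mat n n" and row: "\<And>i. i < n \<Longrightarrow> (\<Sum>j<n. \<bar>A $$ (i, j)\<bar>) \<le> c"
    and ev: "eigenvalue A k"
  shows "\<bar>k\<bar> \<le> c"
proof -
  from ev A obtain v where v: "v \<in> carrier_vec n" "v \<noteq> 0\<^sub>v n" "A *\<^sub>v v = k \<cdot>\<^sub>v v"
    unfolding eigenvalue_def eigenvector_def by auto
  define w where "w i = vec_index v i" for i
  have eq: "(\<Sum>j<n. A $$ (i, j) * w j) = k * w i" if "i < n" for i
  proof -
    have "vec_index (A *\<^sub>v v) i = vec_index (k \<cdot>\<^sub>v v) i" by (simp add: v(3))
    then show ?thesis using that A v(1)
      by (simp add: scalar_prod_def atLeast0LessThan w_def)
  qed
  obtain i0 where i0: "i0 < n" "w i0 \<noteq> 0" using nonzero_vec_index[OF v(1,2)] by (auto simp: w_def)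
  define m where "m = Max ((\<lambda>i. \<bar>w i\<bar>) ` {..<n})"
  have le: "\<bar>w j\<bar> \<le> m" if "j < n" for j using that by (simp add: m_def)
  have "m \<in> (\<lambda>i. \<bar>w i\<bar>) ` {..<n}" unfolding m_def using i0 by (intro Max_in) auto
  then obtain i where i: "i < n" "m = \<bar>w i\<bar>" by auto
  have m: "m > 0" using le[OF i0(1)] i0(2) by simp
  have "\<bar>k\<bar> * m = \<bar>\<Sum>j<n. A $$ (i, j) * w j\<bar>" using eq[OF i(1)] i(2) by (simp add: abs_mult)
  also have "\<dots> \<le> (\<Sum>j<n. \<bar>A $$ (i, j)\<bar> * \<bar>w j\<bar>)"
    by (rule order_trans[OF sum_abs]) (simp add: abs_mult)
  also have "\<dots> \<le> (\<Sum>j<n. \<bar>A $$ (i, j)\<bar> * m)" by (intro sum_mono mult_left_mono le) auto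
  also have "\<dots> = (\<Sum>j<n. \<bar>A $$ (i, j)\<bar>) * m" by (simp add: sum_distrib_right)
  also have "\<dots> \<le> c * m" using row[OF i(1)] m by simp
  finally show ?thesis using m by simp
qed

subsection \<open>The zeta function\<close>

lemma sums_sum_list:
  fixes f :: "'a \<Rightarrow> nat \<Rightarrow> 'b :: real_normed_vector"
  assumes "\<And>a. a \<in> set as \<Longrightarrow> f a sums s a"
  shows "(\<lambda>k. \<Sum>a\<leftarrow>as. f a k) sums (\<Sum>a\<leftarrow>as. s a)"
  using assms by (induction as) (auto intro: sums_add)

context regular_simple_graph
begin

lemma trans_matrix_carrier: "trans_matrix N E \<in> carrier_mat N N"
  by (simp add: trans_matrix_def)

lemma trans_matrix_index:
  assumes "u < N" "v < N"
  shows "trans_matrix N E $$ (u, v) = of_bool (E u v) / (real q + 1)"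
  using assms regular by (simp add: trans_matrix_def Defs.degree_def regular_graph_def add.commute)

text \<open>By regularity the adjacency matrix is \<open>q + 1\<close> times the transition matrix;
  this supplies the factor \<open>c\<close> for \<open>lucas_trace\<close>.\<close>

lemma sum_nbrs_eq_trans_matrix:
  assumes "y < N"
  shows "(\<Sum>z\<in>nbrs y. g z) = (real q + 1) * (\<Sum>z<N. g z * trans_matrix N E $$ (z, y))"
proof -
  have "(\<Sum>z\<in>nbrs y. g z) = (\<Sum>z<N. if E z y then g z else 0)"
    by (intro sum.mono_neutral_cong_left) (auto simp: E_sym dest: E_less)
  also have "\<dots> = (\<Sum>z<N. (real q + 1) * (g z * trans_matrix N E $$ (z, y)))"
    by (intro sum.cong refl) (simp add: trans_matrix_index assms)
  finally show ?thesis by (simp add: sum_distrib_left)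
qed

lemma trans_matrix_char_poly_splits:
  "\<exists>es. char_poly (trans_matrix N E) = (\<Prod>a\<leftarrow>es. [:- a, 1:])"
  by (rule symmetric_char_poly_splits[OF trans_matrix_carrier])
    (simp add: trans_matrix_index E_sym)

text \<open>The transition matrix is nonnegative with row sums 1.\<close>

lemma trans_matrix_eigenvalue_bound:
  assumes es: "char_poly (trans_matrix N E) = (\<Prod>a\<leftarrow>es. [:- a, 1:])" and a: "a \<in> set es"
  shows "\<bar>a\<bar> \<le> 1"
proof (rule abs_eigenvalue_le[OF trans_matrix_carrier])
  fix i assume i: "i < N"
  have "(\<Sum>j<N. \<bar>trans_matrix N E $$ (i, j)\<bar>) = (\<Sum>j<N. 1 * trans_matrix N E $$ (j, i))"
    using i by (intro sum.cong refl) (simp add: trans_matrix_index E_sym)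
  then show "(\<Sum>j<N. \<bar>trans_matrix N E $$ (i, j)\<bar>) \<le> 1"
    using sum_nbrs_eq_trans_matrix[OF i, of "\<lambda>_. 1"] card_nbrs[OF i] by (simp add: add.commute)
next
  have "poly (char_poly (trans_matrix N E)) a = 0"
    unfolding es using a by (simp add: poly_prod_list prod_list_zero_iff)
  then show "eigenvalue (trans_matrix N E) a"
    using eigenvalue_root_char_poly[OF trans_matrix_carrier] by blast
qed

lemma cheb_trace:
  assumes es: "char_poly (trans_matrix N E) = (\<Prod>a\<leftarrow>es. [:- a, 1:])"
  shows "(\<Sum>x<N. cheb k x x) = (\<Sum>a\<leftarrow>es. lucas (real q) ((real q + 1) * a) k)"
  by (rule lucas_trace[OF trans_matrix_carrier es])
    (simp_all add: trans_matrix_index sum_nbrs_eq_trans_matrix)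

text \<open>By transitivity each vertex carries the average of the counts, twice the trace over
  \<open>N\<close>. The sum of the powers of \<open>t\<close> and \<open>- t\<close> is twice the
  power or 0 according to parity, so one formula covers even and odd lengths.\<close>

lemma N_alt_eq:
  assumes vt: "vertex_transitive N E" and x: "x < N"
    and es: "char_poly (trans_matrix N E) = (\<Prod>a\<leftarrow>es. [:- a, 1:])"
  shows "real (N_alt E x (Suc k)) * t ^ Suc k =
    (\<Sum>a\<leftarrow>es. lucas (real q) ((real q + 1) * a) (Suc k) * (t ^ Suc k + (- t) ^ Suc k)) / real N
    + (real q - 1) * (t ^ Suc k + (- t) ^ Suc k)"
proof (cases "even (Suc k)")
  case True
  have "(\<Sum>y<N. real (N_alt E x (Suc k))) = (\<Sum>y<N. real (N_alt E y (Suc k)))"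
    using N_alt_vertex_transitive[OF vt x] by (intro sum.cong refl arg_cong[of _ _ real]) auto
  then have "real N * real (N_alt E x (Suc k)) = (\<Sum>y<N. real (N_alt E y (Suc k)))" by simp
  also have "\<dots> = 2 * nb_trace (Suc k)"
    by (simp add: N_alt_even[OF True] nb_trace_def sum_distrib_left del: nb.simps)
  also have "\<dots> = 2 * ((\<Sum>a\<leftarrow>es. lucas (real q) ((real q + 1) * a) (Suc k)) + (real q - 1) * real N)"
    unfolding nb_trace_eq cheb_trace[OF es] using True by simp
  finally have "real (N_alt E x (Suc k)) =
      2 * (\<Sum>a\<leftarrow>es. lucas (real q) ((real q + 1) * a) (Suc k)) / real N + 2 * (real q - 1)"
    using x by (simp add: field_simps)
  moreover have "t ^ Suc k + (- t) ^ Suc k = 2 * t ^ Suc k"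
    using True by (simp only: power_minus_even mult_2)
  ultimately show ?thesis
    by (simp only: sum_list_mult_const) (simp add: algebra_simps)
next
  case False
  then have "(- t) ^ Suc k = - (t ^ Suc k)" by (rule power_minus_odd)
  then show ?thesis by (simp only: N_alt_odd[OF False]) simp
qed

text \<open>Divide \<open>N_alt_eq\<close> by the length and sum: the finite sum over eigenvalues
  commutes with the series and yields the spectral integral, and the \<open>q - 1\<close> term
  yields the power of \<open>1 - t\<^sup>2\<close>.\<close>

lemma inverse_alt_zeta_eq:
  assumes vt: "vertex_transitive N E" and x: "x < N" and q: "1 \<le> q" and t: "\<bar>t\<bar> < 1 / real q"
  shows "inverse (alt_zeta E x t) = (1 - t\<^sup>2) ^ (q - 1) *
    exp (spectral_integral (trans_matrix N E)
      (\<lambda>y. ln ((1 + real q * t\<^sup>2)\<^sup>2 - (real q + 1)\<^sup>2 * t\<^sup>2 * y\<^sup>2)))"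
proof -
  obtain es where es: "char_poly (trans_matrix N E) = (\<Prod>a\<leftarrow>es. [:- a, 1:])"
    using trans_matrix_char_poly_splits by blast
  let ?f = "\<lambda>y. ln ((1 + real q * t\<^sup>2)\<^sup>2 - (real q + 1)\<^sup>2 * t\<^sup>2 * y\<^sup>2)"
  let ?S = "spectral_integral (trans_matrix N E) ?f"
  have t1: "\<bar>t\<bar> < 1"
    using t q by (auto intro: less_le_trans simp: divide_le_eq_1)
  have "(\<lambda>k. lucas (real q) ((real q + 1) * a) (Suc k) * (t ^ Suc k + (- t) ^ Suc k) / real (Suc k))
      sums - ?f a" if a: "a \<in> set es" for a
  proof -
    have "\<bar>(real q + 1) * a\<bar> \<le> real q + 1"
      using mult_left_mono[OF trans_matrix_eigenvalue_bound[OF es a], of "real q + 1"]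
      by (simp add: abs_mult)
    from lucas_even_log_sums[OF _ this t] q show ?thesis
      by (simp add: power_mult_distrib mult_ac del: lucas.simps power_Suc)
  qed
  then have "(\<lambda>k. (\<Sum>a\<leftarrow>es. lucas (real q) ((real q + 1) * a) (Suc k) * (t ^ Suc k + (- t) ^ Suc k)
        / real (Suc k)) / real N + (real q - 1) * ((t ^ Suc k + (- t) ^ Suc k) / real (Suc k)))
      sums ((\<Sum>a\<leftarrow>es. - ?f a) / real N + (real q - 1) * - ln (1 - t\<^sup>2))"
    by (intro sums_add sums_divide sums_mult sums_sum_list even_power_log_sums t1)
  also have "(\<lambda>k. (\<Sum>a\<leftarrow>es. lucas (real q) ((real q + 1) * a) (Suc k) * (t ^ Suc k + (- t) ^ Suc k)
        / real (Suc k)) / real N + (real q - 1) * ((t ^ Suc k + (- t) ^ Suc k) / real (Suc k)))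
      = (\<lambda>k. real (N_alt E x (Suc k)) / real (Suc k) * t ^ Suc k)"
  proof
    fix k
    have div: "(\<Sum>a\<leftarrow>es. g a / c) = (\<Sum>a\<leftarrow>es. g a) / c" for g :: "real \<Rightarrow> real" and c
      by (induction es) (simp_all add: add_divide_distrib)
    have "real (N_alt E x (Suc k)) / real (Suc k) * t ^ Suc k
        = real (N_alt E x (Suc k)) * t ^ Suc k / real (Suc k)" by simp
    also have "\<dots> = (\<Sum>a\<leftarrow>es. lucas (real q) ((real q + 1) * a) (Suc k) * (t ^ Suc k + (- t) ^ Suc k)
        / real (Suc k)) / real N + (real q - 1) * ((t ^ Suc k + (- t) ^ Suc k) / real (Suc k))"
      unfolding N_alt_eq[OF vt x es] div
      by (simp add: add_divide_distrib mult.commute del: lucas.simps power_Suc of_nat_Suc)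
    finally show "(\<Sum>a\<leftarrow>es. lucas (real q) ((real q + 1) * a) (Suc k) * (t ^ Suc k + (- t) ^ Suc k)
        / real (Suc k)) / real N + (real q - 1) * ((t ^ Suc k + (- t) ^ Suc k) / real (Suc k))
        = real (N_alt E x (Suc k)) / real (Suc k) * t ^ Suc k" by simp
  qed
  also have "(\<Sum>a\<leftarrow>es. - ?f a) / real N + (real q - 1) * - ln (1 - t\<^sup>2)
      = - (?S + real (q - 1) * ln (1 - t\<^sup>2))"
  proof -
    have "(\<Sum>a\<leftarrow>es. - ?f a) = - (\<Sum>a\<leftarrow>es. ?f a)"
      by (rule uminus_sum_list_map[symmetric, unfolded o_def])
    moreover have "?S = (\<Sum>a\<leftarrow>es. ?f a) / real N"
      unfolding spectral_integral_eq[OF es] by (simp add: trans_matrix_def)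
    ultimately show ?thesis using q by (simp add: of_nat_diff)
  qed
  finally have "alt_zeta E x t = exp (- (?S + real (q - 1) * ln (1 - t\<^sup>2)))"
    unfolding alt_zeta_def by (simp only: sums_unique[symmetric])
  then have "inverse (alt_zeta E x t) = exp (?S + real (q - 1) * ln (1 - t\<^sup>2))"
    by (simp only: exp_minus inverse_inverse_eq)
  also have "\<dots> = exp (ln (1 - t\<^sup>2)) ^ (q - 1) * exp ?S"
    by (simp only: exp_add exp_of_nat_mult mult.commute)
  also have "exp (ln (1 - t\<^sup>2)) = 1 - t\<^sup>2"
    using t1 by (simp add: abs_square_less_1)
  finally show ?thesis .
qed

end

section \<open>Passage to the limit by weak convergence\<close>

theorem theorem10:
  fixes q :: nat and N :: "nat \<Rightarrow> nat" and E :: "nat \<Rightarrow> nat \<Rightarrow> nat \<Rightarrow> bool"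
    and x0 :: "nat \<Rightarrow> nat" and \<mu>P :: "real measure" and t :: real
  assumes "q \<ge> 1"
    and "\<And>n. simple_graph (N n) (E n)"
    and "\<And>n. connected_graph (N n) (E n)"
    and "\<And>n. vertex_transitive (N n) (E n)"
    and "\<And>n. regular_graph (N n) (E n) (q + 1)"
    and "filterlim N at_top at_top"
    and "\<And>n. x0 n < N n"
    and "prob_space \<mu>P" and "sets \<mu>P = sets borel" and "AE x in \<mu>P. x \<in> {-1..1}"
    and "\<And>f. continuous_on UNIV f \<Longrightarrow> bounded (range f) \<Longrightarrow>
           (\<lambda>n. spectral_integral (trans_matrix (N n) (E n)) f) \<longlonglongrightarrow> (\<integral>x. f x \<partial>\<mu>P)"
    and "\<bar>t\<bar> < 1 / real (q + 1)"
  shows "(\<lambda>n. inverse (alt_zeta (E n) (x0 n) t)) \<longlonglongrightarrow>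
           (1 - t^2) ^ (q - 1) *
           exp (\<integral>y. ln ((1 + real q * t^2)^2 - (real q + 1)^2 * t^2 * y^2) \<partial>\<mu>P)"
proof -
  let ?f = "\<lambda>y. ln ((1 + real q * t^2)^2 - (real q + 1)^2 * t^2 * y^2)"
  \<comment> \<open>\<open>?f\<close> need not be bounded or continuous outside \<open>[-1, 1]\<close>, so the test function is truncated.\<close>
  define g where "g y = ln ((1 + real q * t^2)^2 - (real q + 1)^2 * t^2 * min 1 (y^2))" for y
  have t: "\<bar>t\<bar> < 1 / real q"
    using assms(1,12) by (auto intro: less_le_trans simp: frac_le)
  have fg: "?f y = g y" if "\<bar>y\<bar> \<le> 1" for y
    using that by (simp add: g_def min_absorb2 abs_square_le_1)
  \<comment> \<open>The smallest value of the argument of the logarithm in \<open>g\<close>,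
    attained when \<open>y^2\<close> is at least 1. It is positive as the product of the quadratics
    of \<open>char_quadratic_pos\<close> at \<open>t\<close> and \<open>- t\<close> for
    \<open>x = q + 1\<close>.\<close>
  let ?m = "(1 + real q * t^2)^2 - (real q + 1)^2 * t^2"
  have m: "0 < ?m"
  proof -
    have "0 < (1 - (real q + 1) * t + real q * t^2) * (1 - (real q + 1) * (- t) + real q * (- t)^2)"
      using t assms(1) by (intro mult_pos_pos char_quadratic_pos) auto
    also have "\<dots> = ?m" by (simp add: algebra_simps power2_eq_square)
    finally show ?thesis .
  qed
  have lower: "?m \<le> (1 + real q * t^2)^2 - (real q + 1)^2 * t^2 * min 1 (y^2)" for y :: real
    by (simp add: mult_left_le)
  have upper: "(1 + real q * t^2)^2 - (real q + 1)^2 * t^2 * min 1 (y^2) \<le> (1 + real q * t^2)^2"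
    for y :: real by simp
  note pos = less_le_trans[OF m lower]
  have cont: "continuous_on UNIV g"
    unfolding g_def
    by (intro continuous_intros ballI) (rule pos[THEN less_imp_neq, THEN not_sym])
  have bdd: "bounded (range g)"
    unfolding bounded_iff
  proof (intro exI ballI)
    fix z assume "z \<in> range g"
    then obtain y where z: "z = g y" by blast
    have "ln ?m \<le> z" unfolding z g_def by (rule iffD2[OF ln_le_cancel_iff[OF m pos] lower])
    moreover have "z \<le> ln ((1 + real q * t^2)^2)"
      unfolding z g_def
      by (rule iffD2[OF ln_le_cancel_iff[OF pos less_le_trans[OF pos upper]] upper])
    ultimately show "norm z \<le> \<bar>ln ?m\<bar> + \<bar>ln ((1 + real q * t^2)^2)\<bar>"
      unfolding real_norm_def by linarith
  qed
  \<comment> \<open>All eigenvalues lie in \<open>[-1, 1]\<close>, where the truncation changes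
    nothing.\<close>
  have spec: "spectral_integral (trans_matrix (N n) (E n)) ?f
      = spectral_integral (trans_matrix (N n) (E n)) g" for n
  proof -
    interpret regular_simple_graph "N n" "E n" q using assms by unfold_locales auto
    obtain es where es: "char_poly (trans_matrix (N n) (E n)) = (\<Prod>a\<leftarrow>es. [:- a, 1:])"
      using trans_matrix_char_poly_splits by blast
    have "map ?f es = map g es"
      using trans_matrix_eigenvalue_bound[OF es] fg by (intro map_cong) auto
    then show ?thesis unfolding spectral_integral_eq[OF es] by (simp only:)
  qed
  \<comment> \<open>The limit measure is concentrated on \<open>[-1, 1]\<close>, so the integrands
    agree almost everywhere.\<close>
  have int: "(\<integral>y. ?f y \<partial>\<mu>P) = (\<integral>y. g y \<partial>\<mu>P)"
  proof (rule integral_cong_AE)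
    show "?f \<in> borel_measurable \<mu>P" "g \<in> borel_measurable \<mu>P"
      unfolding measurable_cong_sets[OF assms(9) refl] g_def by measurable
    show "AE y in \<mu>P. ?f y = g y"
      using assms(10) by eventually_elim (use fg in auto)
  qed
  have "inverse (alt_zeta (E n) (x0 n) t)
      = (1 - t^2) ^ (q - 1) * exp (spectral_integral (trans_matrix (N n) (E n)) g)" for n
  proof -
    interpret regular_simple_graph "N n" "E n" q using assms by unfold_locales auto
    show ?thesis
      unfolding spec[symmetric] using assms t by (intro inverse_alt_zeta_eq) auto
  qed
  moreover have "(\<lambda>n. (1 - t^2) ^ (q - 1) * exp (spectral_integral (trans_matrix (N n) (E n)) g))
      \<longlonglongrightarrow> (1 - t^2) ^ (q - 1) * exp (\<integral>y. g y \<partial>\<mu>P)"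
    by (intro tendsto_intros assms(11) cont bdd)
  ultimately show ?thesis unfolding int by simp
qed

end
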